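(* Let $V$ be a finite-dimensional irreducible $\mathcal{A}$-module of type $B(d)$ or $AB(d,0)$. Then for each of $x,y,z$ the action on $V$ is diagonalizable. If $V$ is of type $B(d)$, the eigenvalues of each of $x,y,z$ on $V$ are $(-1)^{i}(d-2i)$ for $0\le i\le d$. If $V$ is of type $AB(d,0)$, the eigenvalues of each of $x,y,z$ on $V$ are $(-1)^{d+i}(2d-2i+1)$ for $0\le i\le d$.
   Context: $\mathbb{K}$ is an algebraically closed field of characteristic zero. $\mathcal{A}$ is the unital associative $\mathbb{K}$-algebra with generators $x,y,z$ and relations $xy+yx=2z$, $yz+zy=2x$, $zx+xz=2y$. Type $B(d)$ ($d\ge 0$ even): an $\mathcal{A}$-module is of type $B(d)$ if it is isomorphic to the irreducible module with basis $\{v_i\}_{i=0}^d$ and, for $0\le i\le d$: $x.v_i=(-1)^i(d-2i)v_i$, $y.v_i=(d-i+1)v_{i-1}+(i+1)v_{i+1}$, $z.v_i=(-1)^{i-1}(d-i+1)v_{i-1}+(-1)^i(i+1)v_{i+1}$, with $v_{-1}=0=v_{d+1}$. Type $AB(d,0)$ ($d\ge 0$ an integer): an $\mathcal{A}$-module is of type $AB(d,0)$ if it is isomorphic to the irreducible module with basis $\{v_i\}_{i=0}^d$ and, for $0\le i\le d$: $x.v_i=(-1)^{d+i}(2d-2i+1)v_i$, $y.v_i=(-1)^d(2d-i+2)v_{i-1}+(-1)^d(i+1)v_{i+1}$, $z.v_i=(-1)^{i-1}(2d-i+2)v_{i-1}+(-1)^i(i+1)v_{i+1}$, with $v_{-1}=0$,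 $v_{d+1}=v_d$. *)

theory Defs
  imports "HOL-Computational_Algebra.Polynomial" "HOL-Library.Poly_Mapping"
begin

section \<open>The algebra\<close>

datatype gen = X | Y | Z

text \<open>Words in the generators form the free monoid. It is written additively because
  multiplication on \<^typ>\<open>('a, 'b) poly_mapping\<close> is convolution over an additive monoid;
  the finitely supported functions on words are thus the free associative unital algebra on
  \<^const>\<open>X\<close>, \<^const>\<open>Y\<close>, \<^const>\<open>Z\<close>.\<close>

datatype word = Word (letters: "gen list")

instantiation word :: monoid_add
begin

definition zero_word :: word where "0 = Word []"

definition plus_word :: "word \<Rightarrow> word \<Rightarrow> word" where
  "u + v = Word (letters u @ letters v)"

instance
  by standard (auto simp: zero_word_def plus_word_def)

end

type_synonym 'k free_alg = "word \<Rightarrow>\<^sub>0 'k"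

definition free_gen :: "gen \<Rightarrow> 'k::field free_alg" where
  "free_gen g = Poly_Mapping.single (Word [g]) 1"

text \<open>The two-sided ideal generated by $xy+yx-2z$, $yz+zy-2x$, $zx+xz-2y$.\<close>

inductive relator_ideal :: "'k::field free_alg \<Rightarrow> bool" where
  rel_xy: "relator_ideal (free_gen X * free_gen Y + free_gen Y * free_gen X - 2 * free_gen Z)"
| rel_yz: "relator_ideal (free_gen Y * free_gen Z + free_gen Z * free_gen Y - 2 * free_gen X)"
| rel_zx: "relator_ideal (free_gen Z * free_gen X + free_gen X * free_gen Z - 2 * free_gen Y)"
| zero: "relator_ideal 0"
| add: "relator_ideal p \<Longrightarrow> relator_ideal q \<Longrightarrow> relator_ideal (p + q)"
| mult_left: "relator_ideal p \<Longrightarrow> relator_ideal (r * p)"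
| mult_right: "relator_ideal p \<Longrightarrow> relator_ideal (p * r)"

lemma relator_ideal_uminus: "relator_ideal p \<Longrightarrow> relator_ideal (- p)"
  using relator_ideal.mult_left[of p "-1"] by simp

definition relator_cong :: "'k::field free_alg \<Rightarrow> 'k free_alg \<Rightarrow> bool" where
  "relator_cong p q \<longleftrightarrow> relator_ideal (p - q)"

lemma equivp_relator_cong: "equivp (relator_cong :: 'k::field free_alg \<Rightarrow> _)"
proof (rule equivpI)
  show "reflp (relator_cong :: 'k free_alg \<Rightarrow> _)"
    by (auto simp: reflp_def relator_cong_def relator_ideal.zero)
  show "symp (relator_cong :: 'k free_alg \<Rightarrow> _)"
    unfolding symp_def relator_cong_def by (metis minus_diff_eq relator_ideal_uminus)
  show "transp (relator_cong :: 'k free_alg \<Rightarrow> _)"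
  proof (rule transpI)
    fix p q r :: "'k free_alg"
    assume "relator_cong p q" "relator_cong q r"
    then have "relator_ideal ((p - q) + (q - r))"
      unfolding relator_cong_def by (rule relator_ideal.add)
    then show "relator_cong p r" by (simp add: relator_cong_def)
  qed
qed

text \<open>The augmentation $x,y,z \mapsto 1$ kills the relators, so the quotient is not zero.\<close>

definition augmentation :: "'k::field free_alg \<Rightarrow> 'k" where
  "augmentation p = (\<Sum>w. Poly_Mapping.lookup p w)"

lemma augmentation_single [simp]: "augmentation (Poly_Mapping.single w c) = c"
  by (simp add: augmentation_def lookup_single)

lemma augmentation_zero [simp]: "augmentation 0 = 0"
  by (simp add: augmentation_def)

lemma augmentation_add: "augmentation (p + q) = augmentation p + augmentation q"
  unfolding augmentation_def lookup_add by (rule Sum_any.distrib) (rule finite_lookup)+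

lemma augmentation_diff: "augmentation (p - q) = augmentation p - augmentation q"
  using augmentation_add[of "p - q" q] by (simp add: algebra_simps)

lemma free_alg_induct [case_names zero single_add]:
  fixes p :: "'k::field free_alg"
  assumes "P 0" and "\<And>w c q. P q \<Longrightarrow> P (Poly_Mapping.single w c + q)"
  shows "P p"
proof (induction p rule: update_induct)
  case const
  show ?case by fact
next
  case (update q w c)
  have "Poly_Mapping.update w c q = Poly_Mapping.single w c + q"
    using update by (intro poly_mapping_eqI)
      (auto simp: lookup_update lookup_add lookup_single in_keys_iff when_def)
  with update assms(2) show ?case by simp
qed

lemma augmentation_mult: "augmentation (p * q) = augmentation p * augmentation q"
proof (induction p rule: free_alg_induct)
  case (single_add w c p)
  have "augmentation (Poly_Mapping.single w c * q) = c * augmentation q"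
    by (induction q rule: free_alg_induct)
       (simp_all add: distrib_left augmentation_add mult_single)
  with single_add show ?case by (simp add: distrib_right augmentation_add)
qed simp

lemma augmentation_relator_ideal: "relator_ideal p \<Longrightarrow> augmentation p = 0"
proof (induction rule: relator_ideal.induct)
qed (simp_all add: augmentation_add augmentation_diff augmentation_mult free_gen_def
      flip: single_numeral)

quotient_type (overloaded) 'k alg_A = "'k::field free_alg" / relator_cong
  by (rule equivp_relator_cong)

instantiation alg_A :: (field) ring_1
begin

lift_definition zero_alg_A :: "'a alg_A" is 0 .
lift_definition one_alg_A :: "'a alg_A" is 1 .

lift_definition plus_alg_A :: "'a alg_A \<Rightarrow> 'a alg_A \<Rightarrow> 'a alg_A" is "(+)"
proof -
  fix p p' q q' :: "'a free_alg"
  assume "relator_cong p p'" "relator_cong q q'"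
  then have "relator_ideal ((p - p') + (q - q'))"
    unfolding relator_cong_def by (rule relator_ideal.add)
  then show "relator_cong (p + q) (p' + q')" by (simp add: relator_cong_def algebra_simps)
qed

lift_definition uminus_alg_A :: "'a alg_A \<Rightarrow> 'a alg_A" is uminus
  unfolding relator_cong_def by (metis minus_diff_minus relator_ideal_uminus)

lift_definition minus_alg_A :: "'a alg_A \<Rightarrow> 'a alg_A \<Rightarrow> 'a alg_A" is "(-)"
proof -
  fix p p' q q' :: "'a free_alg"
  assume "relator_cong p p'" "relator_cong q q'"
  then have "relator_ideal ((p - p') + - (q - q'))"
    unfolding relator_cong_def by (intro relator_ideal.add relator_ideal_uminus)
  then show "relator_cong (p - q) (p' - q')" by (simp add: relator_cong_def algebra_simps)
qed

lift_definition times_alg_A :: "'a alg_A \<Rightarrow> 'a alg_A \<Rightarrow> 'a alg_A" is "(*)"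
proof -
  fix p p' q q' :: "'a free_alg"
  assume "relator_cong p p'" "relator_cong q q'"
  then have "relator_ideal ((p - p') * q + p' * (q - q'))"
    unfolding relator_cong_def
    by (intro relator_ideal.add relator_ideal.mult_left relator_ideal.mult_right)
  then show "relator_cong (p * q) (p' * q')" by (simp add: relator_cong_def algebra_simps)
qed

instance
proof
  show "(0 :: 'a alg_A) \<noteq> 1"
  proof (transfer, unfold relator_cong_def, rule notI)
    assume "relator_ideal (0 - 1 :: 'a free_alg)"
    then have "augmentation (0 - 1 :: 'a free_alg) = 0" by (rule augmentation_relator_ideal)
    then have "augmentation (Poly_Mapping.single 0 1 :: 'a free_alg) = 0"
      unfolding augmentation_diff single_one by simp
    then show False by (simp del: single_one)
  qed
qed (transfer; simp add: relator_cong_def relator_ideal.zero algebra_simps)+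

end

lift_definition scale_A :: "'k::field \<Rightarrow> 'k alg_A \<Rightarrow> 'k alg_A"
  is "\<lambda>c p. Poly_Mapping.single 0 c * p"
  unfolding relator_cong_def right_diff_distrib[symmetric] by (rule relator_ideal.mult_left)

lift_definition gen_A :: "gen \<Rightarrow> 'k::field alg_A" is free_gen .

lemma alg_A_relations:
  "gen_A X * gen_A Y + gen_A Y * gen_A X = scale_A 2 (gen_A Z)"
  "gen_A Y * gen_A Z + gen_A Z * gen_A Y = scale_A 2 (gen_A X)"
  "gen_A Z * gen_A X + gen_A X * gen_A Z = scale_A 2 (gen_A Y)"
  by (transfer, simp add: relator_cong_def relator_ideal.intros)+

lemma single_0_central:
  fixes p :: "'k::field free_alg"
  shows "Poly_Mapping.single 0 c * p = p * Poly_Mapping.single 0 c"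
  by (induction p rule: free_alg_induct)
     (simp_all add: distrib_left distrib_right mult_single mult.commute)

lemma scale_A_algebra:
  "vector_space (scale_A :: 'k::field \<Rightarrow> _)"
  "scale_A c (a * b) = scale_A c a * b"
  "scale_A c (a * b) = a * scale_A c (b :: 'k::field alg_A)"
proof -
  show "vector_space (scale_A :: 'k \<Rightarrow> _)"
    by unfold_locales
       (transfer; simp add: relator_cong_def relator_ideal.zero algebra_simps single_add
          mult_single flip: mult.assoc)+
  show "scale_A c (a * b) = scale_A c a * b"
    by transfer (simp add: relator_cong_def relator_ideal.zero mult.assoc)
  show "scale_A c (a * b) = a * scale_A c b"
  proof transfer
    fix c :: 'k and a b :: "'k free_alg"
    have "Poly_Mapping.single 0 c * (a * b) = a * (Poly_Mapping.single 0 c * b)"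
      by (metis mult.assoc single_0_central)
    then show "relator_cong (Poly_Mapping.single 0 c * (a * b)) (a * (Poly_Mapping.single 0 c * b))"
      by (simp add: relator_cong_def relator_ideal.zero)
  qed
qed


section \<open>Modules\<close>

locale A_module = vector_space scale
  for scale :: "'k::field \<Rightarrow> 'v::ab_group_add \<Rightarrow> 'v" +
  fixes act :: "'k alg_A \<Rightarrow> 'v \<Rightarrow> 'v"
  assumes act_linear: "Vector_Spaces.linear scale scale (act a)"
    and act_add: "act (a + b) v = act a v + act b v"
    and act_scale: "act (scale_A c a) v = scale c (act a v)"
    and act_mult: "act (a * b) v = act a (act b v)"
    and act_one: "act 1 v = v"

definition A_submodule ::
  "('k::field \<Rightarrow> 'v::ab_group_add \<Rightarrow> 'v) \<Rightarrow> ('k alg_A \<Rightarrow> 'v \<Rightarrow> 'v) \<Rightarrow> 'v set \<Rightarrow> bool" where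
  "A_submodule scale act W \<longleftrightarrow>
     module.subspace scale W \<and> (\<forall>a. \<forall>w\<in>W. act a w \<in> W)"

definition irreducible_A_module ::
  "('k::field \<Rightarrow> 'v::ab_group_add \<Rightarrow> 'v) \<Rightarrow> ('k alg_A \<Rightarrow> 'v \<Rightarrow> 'v) \<Rightarrow> bool" where
  "irreducible_A_module scale act \<longleftrightarrow>
     A_module scale act \<and> (UNIV :: 'v set) \<noteq> {0} \<and>
     (\<forall>W. A_submodule scale act W \<longrightarrow> W = {0} \<or> W = UNIV)"

definition is_basis :: "('k::field \<Rightarrow> 'v::ab_group_add \<Rightarrow> 'v) \<Rightarrow> 'v set \<Rightarrow> bool" where
  "is_basis scale B \<longleftrightarrow> \<not> module.dependent scale B \<and> module.span scale B = UNIV"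

definition finite_dim :: "('k::field \<Rightarrow> 'v::ab_group_add \<Rightarrow> 'v) \<Rightarrow> bool" where
  "finite_dim scale \<longleftrightarrow> (\<exists>B. finite B \<and> is_basis scale B)"

text \<open>A module is isomorphic to a module given by structure formulas on a basis exactly when
  it has itself a basis satisfying these formulas (the image of the given basis), which is
  how the two types are phrased. The basis is indexed by \<^typ>\<open>int\<close>, so that the boundary
  values $v_{-1}$ and $v_{d+1}$ are values of the same family; the values outside
  $-1,\dots,d+1$ play no role.\<close>

definition type_B ::
  "nat \<Rightarrow> ('k::field \<Rightarrow> 'v::ab_group_add \<Rightarrow> 'v) \<Rightarrow> ('k alg_A \<Rightarrow> 'v \<Rightarrow> 'v) \<Rightarrow> bool" where
  "type_B d scale act \<longleftrightarrow>
     even d \<and> irreducible_A_module scale act \<and>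
     (\<exists>v :: int \<Rightarrow> 'v.
        inj_on v {0..int d} \<and> is_basis scale (v ` {0..int d}) \<and>
        v (-1) = 0 \<and> v (int d + 1) = 0 \<and>
        (\<forall>i\<in>{0..int d}.
           act (gen_A X) (v i) = scale ((-1) powi i * of_int (int d - 2 * i)) (v i) \<and>
           act (gen_A Y) (v i) =
             scale (of_int (int d - i + 1)) (v (i - 1)) + scale (of_int (i + 1)) (v (i + 1)) \<and>
           act (gen_A Z) (v i) =
             scale ((-1) powi (i - 1) * of_int (int d - i + 1)) (v (i - 1)) +
             scale ((-1) powi i * of_int (i + 1)) (v (i + 1))))"

definition type_AB0 ::
  "nat \<Rightarrow> ('k::field \<Rightarrow> 'v::ab_group_add \<Rightarrow> 'v) \<Rightarrow> ('k alg_A \<Rightarrow> 'v \<Rightarrow> 'v) \<Rightarrow> bool" where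
  "type_AB0 d scale act \<longleftrightarrow>
     irreducible_A_module scale act \<and>
     (\<exists>v :: int \<Rightarrow> 'v.
        inj_on v {0..int d} \<and> is_basis scale (v ` {0..int d}) \<and>
        v (-1) = 0 \<and> v (int d + 1) = v (int d) \<and>
        (\<forall>i\<in>{0..int d}.
           act (gen_A X) (v i) =
             scale ((-1) powi (int d + i) * of_int (2 * int d - 2 * i + 1)) (v i) \<and>
           act (gen_A Y) (v i) =
             scale ((-1) ^ d * of_int (2 * int d - i + 2)) (v (i - 1)) +
             scale ((-1) ^ d * of_int (i + 1)) (v (i + 1)) \<and>
           act (gen_A Z) (v i) =
             scale ((-1) powi (i - 1) * of_int (2 * int d - i + 2)) (v (i - 1)) +
             scale ((-1) powi i * of_int (i + 1)) (v (i + 1))))"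


section \<open>Eigenvalues\<close>

definition eigenvector ::
  "('k::field \<Rightarrow> 'v::ab_group_add \<Rightarrow> 'v) \<Rightarrow> ('v \<Rightarrow> 'v) \<Rightarrow> 'k \<Rightarrow> 'v \<Rightarrow> bool" where
  "eigenvector scale f c v \<longleftrightarrow> v \<noteq> 0 \<and> f v = scale c v"

definition eigenvalues ::
  "('k::field \<Rightarrow> 'v::ab_group_add \<Rightarrow> 'v) \<Rightarrow> ('v \<Rightarrow> 'v) \<Rightarrow> 'k set" where
  "eigenvalues scale f = {c. \<exists>v. eigenvector scale f c v}"

definition diagonalizable ::
  "('k::field \<Rightarrow> 'v::ab_group_add \<Rightarrow> 'v) \<Rightarrow> ('v \<Rightarrow> 'v) \<Rightarrow> bool" where
  "diagonalizable scale f \<longleftrightarrow>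
     (\<exists>B. is_basis scale B \<and> (\<forall>b\<in>B. \<exists>c. eigenvector scale f c b))"

end

theory Submission
  imports Defs
begin

text \<open>Put \<open>s = (-1)\<^sup>d\<close>, and \<open>D = d\<close> in type \<open>B(d)\<close>, \<open>D = 2d + 1\<close> in type \<open>AB(d,0)\<close>; then both
  types are given by the same formulas, with boundary condition \<open>(d + 1) v\<^bsub>d+1\<^esub> = (D - d) v\<^sub>d\<close>,
  and the claimed eigenvalues are \<open>\<lambda>\<^sub>i = s (-1)\<^sup>i (D - 2i)\<close>. Each generator \<open>f\<close> has an
  eigenvector for \<open>\<lambda>\<^sub>0 = s D\<close>, a sum of the \<open>v\<^sub>i\<close> with signs. If \<open>g\<close>, \<open>h\<close> are the other two
  generators and \<open>t = 1\<close> or \<open>t = -1\<close>, then \<open>h + t g\<close> maps the eigenspace of \<open>f\<close> for \<open>c\<close> to that for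
  \<open>2t - c\<close>, and its square is \<open>\<Omega> - f\<^sup>2 + 2 t f\<close>, where \<open>\<Omega> = x\<^sup>2 + y\<^sup>2 + z\<^sup>2\<close> is central and acts
  as \<open>D (D + 2)\<close>. So no step of the ladder from \<open>\<lambda>\<^sub>0\<close> to \<open>\<lambda>\<^sub>d\<close> vanishes, and these \<open>d + 1\<close>
  distinct eigenvalues exhaust the dimension.\<close>

section \<open>Eigenvectors for distinct eigenvalues\<close>

context vector_space
begin

text \<open>Induction on \<open>S\<close>: if \<open>e c\<close> were a combination of the other
  \<open>e a\<close>, applying \<open>f\<close> and comparing with \<open>c\<close> times that
  combination would multiply each coefficient by \<open>a - c\<close>, which is nonzero, so all
  coefficients would vanish.\<close>

lemma eigenvectors_independent:
  assumes lin: "Vector_Spaces.linear scale scale f"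
    and "finite S" and "\<And>c. c \<in> S \<Longrightarrow> eigenvector scale f c (e c)"
  shows "inj_on e S \<and> independent (e ` S)"
  using assms(2,3)
proof (induction S rule: finite_induct)
  case empty
  then show ?case by (simp add: dependent_def)
next
  case (insert c S)
  interpret f: Vector_Spaces.linear scale scale f by (rule lin)
  have ev: "f (e a) = scale a (e a)" "e a \<noteq> 0" if "a \<in> insert c S" for a
    using insert.prems[OF that] by (auto simp: eigenvector_def)
  have inj: "inj_on e S" and ind: "independent (e ` S)"
    using insert by auto
  have notin: "e c \<notin> span (e ` S)"
  proof
    assume "e c \<in> span (e ` S)"
    then obtain r where "e c = (\<Sum>v\<in>e ` S. scale (r v) v)"
      using insert.hyps by (auto simp: span_finite)
    then have ec: "e c = (\<Sum>a\<in>S. scale (r (e a)) (e a))"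
      using inj by (simp add: sum.reindex)
    have "(\<Sum>a\<in>S. scale (r (e a) * a) (e a)) = f (e c)"
      by (subst ec) (simp add: f.sum f.scale ev)
    also have "\<dots> = (\<Sum>a\<in>S. scale (r (e a) * c) (e a))"
      by (simp add: ev) (subst ec, simp add: scale_sum_right mult.commute)
    finally have "(\<Sum>a\<in>S. scale (r (e a) * (a - c)) (e a)) = 0"
      by (simp add: algebra_simps sum_subtractf)
    \<comment> \<open>\<open>independentD\<close> expects coefficients indexed by vectors;
      \<open>inv_into\<close> recovers the eigenvalue from its eigenvector.\<close>
    then have "(\<Sum>v\<in>e ` S. scale (r v * (inv_into S e v - c)) v) = 0"
      using inj by (simp add: sum.reindex)
    then have "r v * (inv_into S e v - c) = 0" if "v \<in> e ` S" for v
      using independentD[OF ind _ subset_refl _ that, where u = "\<lambda>v. r v * (inv_into S e v - c)"]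
        insert.hyps(1) by simp
    then have "r (e a) * (a - c) = 0" if "a \<in> S" for a
      using that inj by fastforce
    then have "r (e a) = 0" if "a \<in> S" for a
      using that insert.hyps by auto
    then have "e c = 0"
      by (subst ec) simp
    then show False using ev by auto
  qed
  moreover have "e c \<notin> e ` S"
    using notin span_base by blast
  ultimately show ?case
    using inj ind insert.hyps by (simp add: independent_insert)
qed

text \<open>Choose one eigenvector per eigenvalue. A vector outside the span of those for
  \<open>S\<close>, or an eigenvector for a further eigenvalue, would give an independent set with
  more than \<open>card B\<close> elements.\<close>

lemma diagonalizable_if_enough_eigenvalues:
  assumes lin: "Vector_Spaces.linear scale scale f"
    and basis: "finite B" "is_basis scale B"
    and S: "finite S" "S \<subseteq> eigenvalues scale f" "card B \<le> card S"
  shows "diagonalizable scale f" and "eigenvalues scale f = S"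
proof -
  obtain e where e: "\<And>c. c \<in> eigenvalues scale f \<Longrightarrow> eigenvector scale f c (e c)"
    using bchoice[of "eigenvalues scale f" "eigenvector scale f"] by (auto simp: eigenvalues_def)
  have span: "span B = UNIV"
    using basis by (simp add: is_basis_def)
  have bound: "card C \<le> card B" if "independent C" for C
    using independent_span_bound[OF basis(1) that] span by auto
  have ind: "inj_on e T \<and> independent (e ` T)"
    if "finite T" "T \<subseteq> eigenvalues scale f" for T
    using eigenvectors_independent[OF lin that(1)] e that(2) by blast
  have "v \<in> span (e ` S)" for v
  proof (rule ccontr)
    assume v: "v \<notin> span (e ` S)"
    then have "independent (insert v (e ` S))" and "v \<notin> e ` S"
      using ind[OF S(1,2)] span_base by (auto simp: independent_insert)
    then show False
      using bound[of "insert v (e ` S)"] S ind[OF S(1,2)] by (simp add: card_image)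
  qed
  then have "is_basis scale (e ` S)"
    using ind[OF S(1,2)] by (auto simp: is_basis_def)
  then show "diagonalizable scale f"
    unfolding diagonalizable_def using e S(2) by blast
  show "eigenvalues scale f = S"
  proof (rule ccontr)
    assume "eigenvalues scale f \<noteq> S"
    then obtain c where c: "c \<in> eigenvalues scale f" "c \<notin> S"
      using S(2) by blast
    then have "card (insert c S) \<le> card B"
      using ind[of "insert c S"] bound[of "e ` insert c S"] S(1,2) by (simp add: card_image del: image_insert)
    then show False using c S by simp
  qed
qed

end

section \<open>Three operators satisfying the relations of the algebra, and the ladder\<close>

locale anticommutator_triple = vector_space scale
  for scale :: "'k::field_char_0 \<Rightarrow> 'v::ab_group_add \<Rightarrow> 'v" +
  fixes f g h :: "'v \<Rightarrow> 'v"
  assumes lin: "Vector_Spaces.linear scale scale f" "Vector_Spaces.linear scale scale g"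
      "Vector_Spaces.linear scale scale h"
    and fg: "f (g v) + g (f v) = scale 2 (h v)"
    and gh: "g (h v) + h (g v) = scale 2 (f v)"
    and hf: "h (f v) + f (h v) = scale 2 (g v)"
begin

text \<open>The relations are cyclic, so whatever is proved about \<open>f\<close> carries over to
  \<open>g\<close> and \<open>h\<close>.\<close>

lemma rotate: "anticommutator_triple scale g h f"
  by unfold_locales (use lin fg gh hf in \<open>auto simp: module_hom_iff linear_iff_module_hom\<close>)

sublocale f: Vector_Spaces.linear scale scale f by (rule lin)
sublocale g: Vector_Spaces.linear scale scale g by (rule lin)
sublocale h: Vector_Spaces.linear scale scale h by (rule lin)

lemmas hom_simps = f.add f.scale f.diff f.zero f.neg g.add g.scale g.diff g.zero g.neg
  h.add h.scale h.diff h.zero h.neg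

text \<open>Moving \<open>f\<close> past \<open>g g\<close> leaves \<open>2 (h g - g h)\<close>,
  moving it past \<open>h h\<close> leaves the negative of that, and the two cancel.\<close>

lemma casimir_commute:
  "f (f (f v) + g (g v) + h (h v)) = f (f (f v)) + g (g (f v)) + h (h (f v))"
proof -
  have "f (g u) = scale 2 (h u) - g (f u)" "f (h u) = scale 2 (g u) - h (f u)" for u
    using fg[of u] hf[of u] by (simp_all add: algebra_simps)
  then show ?thesis
    by (simp add: hom_simps)
qed

text \<open>Moving \<open>f\<close> past \<open>g\<close> produces \<open>2 h\<close>, past
  \<open>h\<close> it produces \<open>2 g\<close>; as \<open>t * t = 1\<close>, the result is again
  proportional to \<open>h u + t g u\<close>.\<close>

lemma ladder_eigenvector:
  assumes "f u = scale c u" and "t * t = 1"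
  shows "f (h u + scale t (g u)) = scale (2 * t - c) (h u + scale t (g u))"
proof -
  have "f (g u) = scale 2 (h u) - scale c (g u)" "f (h u) = scale 2 (g u) - scale c (h u)"
    using fg[of u] hf[of u] assms(1) by (simp_all add: algebra_simps hom_simps)
  moreover have "(2 * t - c) * t = 2 - t * c"
    using assms(2) by (simp add: algebra_simps)
  ultimately show ?thesis
    by (simp add: hom_simps scale_right_distrib scale_right_diff_distrib scale_left_diff_distrib
        mult.commute)
qed

text \<open>Applying \<open>h + t g\<close> once more returns a nonzero multiple of
  \<open>u\<close>: on \<open>u\<close>, \<open>g g + h h\<close> acts as \<open>m - c * c\<close>
  and \<open>t (g h + h g) = 2 t f\<close> as \<open>2 * t * c\<close>.\<close>

lemma ladder_nonzero:
  assumes "f u = scale c u" and t: "t * t = 1" and "u \<noteq> 0"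
    and cas: "f (f u) + g (g u) + h (h u) = scale m u"
    and "m - c * c + 2 * t * c \<noteq> 0"
  shows "h u + scale t (g u) \<noteq> 0"
proof
  assume "h u + scale t (g u) = 0"
  then have "h (h u + scale t (g u)) + scale t (g (h u + scale t (g u))) = 0"
    by (simp add: hom_simps)
  then have "(h (h u) + g (g u)) + scale t (g (h u) + h (g u)) = 0"
    using t by (simp add: hom_simps algebra_simps)
  moreover have "h (h u) + g (g u) = scale (m - c * c) u"
    using cas assms(1) by (simp add: hom_simps algebra_simps)
  moreover have "scale t (g (h u) + h (g u)) = scale (2 * t * c) u"
    using assms(1) by (simp add: gh mult.commute)
  ultimately have "scale (m - c * c + 2 * t * c) u = 0"
    by (simp only: scale_left_distrib)
  with assms show False by simp
qed

end

section \<open>The string of eigenvalues and the spectrum it determines\<close>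

definition string_eigenvalue :: "nat \<Rightarrow> nat \<Rightarrow> nat \<Rightarrow> 'k::field_char_0" where
  "string_eigenvalue d D i = (-1) ^ (d + i) * of_int (int D - 2 * int i)"

text \<open>Indices of equal parity have equal signs, so \<open>D - 2i\<close> decides. Opposite
  parity would force \<open>i + j = D\<close>, impossible: either \<open>D\<close> is even while
  \<open>i + j\<close> is odd, or \<open>D = 2d + 1\<close> exceeds \<open>i + j\<close>.\<close>

lemma inj_on_string_eigenvalue:
  assumes "D = d \<and> even d \<or> D = 2 * d + 1"
  shows "inj_on (string_eigenvalue d D :: nat \<Rightarrow> 'k::field_char_0) {..d}"
proof (rule inj_onI)
  fix i j assume ij: "i \<in> {..d}" "j \<in> {..d}"
    and eq: "string_eigenvalue d D i = (string_eigenvalue d D j :: 'k)"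
  have "of_int ((-1) ^ (d + i) * (int D - 2 * int i)) =
      (of_int ((-1) ^ (d + j) * (int D - 2 * int j)) :: 'k)"
    using eq by (simp add: string_eigenvalue_def)
  then have eq: "(-1) ^ (d + i) * (int D - 2 * int i) = (-1) ^ (d + j) * (int D - 2 * int j)"
    by (simp only: of_int_eq_iff)
  show "i = j"
  proof (cases "even (i + j)")
    case True
    then have "(-1) ^ (d + i) = ((-1) ^ (d + j) :: int)"
      by (simp add: minus_one_power_iff)
    then show ?thesis using eq by simp
  next
    case False
    then have "(-1) ^ (d + i) = - ((-1) ^ (d + j) :: int)"
      by (auto simp: minus_one_power_iff)
    then have "(-1) ^ (d + j) * (int D - 2 * int i) = (-1) ^ (d + j) * (2 * int j - int D)"
      using eq by (simp add: algebra_simps)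
    then have "int D - 2 * int i = 2 * int j - int D"
      by (subst (asm) mult_cancel_left) simp
    then have "i + j = D" by linarith
    then show ?thesis using False assms ij by auto
  qed
qed

context anticommutator_triple
begin

lemma string_eigenvalues:
  assumes cas: "\<And>u. f (f u) + g (g u) + h (h u) = scale (of_nat (D * (D + 2))) u"
    and u: "eigenvector scale f (string_eigenvalue d D 0) u"
    and "d \<le> D" and "i \<le> d"
  shows "string_eigenvalue d D i \<in> eigenvalues scale f"
  using \<open>i \<le> d\<close>
proof (induction i)
  case 0
  then show ?case using u by (auto simp: eigenvalues_def)
next
  case (Suc i)
  let ?l = "string_eigenvalue d D :: nat \<Rightarrow> 'k"
  \<comment> \<open>The sign for which the ladder maps the i-th eigenvalue to the next one.\<close>
  define t :: 'k where "t = (-1) ^ (d + i)"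
  have t: "t * t = 1"
    by (simp add: t_def flip: power_mult_distrib)
  have l: "?l i = t * (of_nat D - 2 * of_nat i)" "?l (Suc i) = 2 * t - ?l i"
    by (simp_all add: string_eigenvalue_def t_def algebra_simps)
  obtain u where u: "u \<noteq> 0" "f u = scale (?l i) u"
    using Suc by (auto simp: eigenvalues_def eigenvector_def)
  have "?l i * ?l i = (of_nat D - 2 * of_nat i)\<^sup>2" "t * ?l i = of_nat D - 2 * of_nat i"
    using t l(1) by algebra+
  \<comment> \<open>The factor \<open>D - i\<close> is nonzero because \<open>i < d\<close> and
    \<open>d \<le> D\<close>.\<close>
  then have "of_nat (D * (D + 2)) - ?l i * ?l i + 2 * t * ?l i
      = 4 * of_nat (Suc i) * (of_nat D - of_nat i)"
    by (simp add: mult.assoc) (simp add: power2_eq_square algebra_simps)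
  also have "\<dots> \<noteq> 0"
    using Suc.prems \<open>d \<le> D\<close> by (simp del: of_nat_Suc)
  finally have "h u + scale t (g u) \<noteq> 0"
    using ladder_nonzero[OF u(2) t u(1) cas] by blast
  then show ?case
    using ladder_eigenvector[OF u(2) t] unfolding l(2)
    by (auto simp: eigenvalues_def eigenvector_def)
qed

end

text \<open>The signs \<open>t\<close> allow one computation to serve both \<open>g\<close>
  (constant signs) and \<open>h\<close> (alternating signs).\<close>

lemma (in vector_space) string_eigenvector:
  fixes w :: "nat \<Rightarrow> 'b" and t :: "nat \<Rightarrow> 'a" and D d :: nat
  assumes lin: "Vector_Spaces.linear scale scale f"
    and w0: "f (w 0) = scale (t 0) (w 1)"
    and wS: "\<And>n. n < d \<Longrightarrow> f (w (Suc n)) =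
      scale (t n * (of_nat D - of_nat n)) (w n) + scale (t (Suc n) * of_nat (n + 2)) (w (n + 2))"
    and wd: "scale (of_nat (Suc d)) (w (Suc d)) = scale (of_nat D - of_nat d) (w d)"
    and t: "\<And>n. t n * t n = 1"
    and indep: "independent (w ` {..d})" "inj_on w {..d}"
  shows "\<exists>u. eigenvector scale f (t d * of_nat D) u"
proof -
  interpret f: Vector_Spaces.linear scale scale f by (rule lin)
  \<comment> \<open>With this choice both boundary terms of \<open>f (p d)\<close> carry the factor
    \<open>s * e d\<close>, and \<open>wd\<close> cancels them.\<close>
  define s where "s = t d"
  \<comment> \<open>Signs for which the neighbours of an inner \<open>w i\<close> contribute
    \<open>s * i * e i\<close> and \<open>s * (D - i) * e i\<close>, adding up to
    \<open>s * D * e i\<close>.\<close>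
  define e where "e n = (\<Prod>j<n. s * t j)" for n
  define p where "p n = (\<Sum>i\<le>n. scale (e i) (w i))" for n
  have s: "s * s = 1" using t s_def by simp
  have eS: "e (Suc n) * t n = s * e n" "e n * t n = s * e (Suc n)" for n
    using s t[of n] by (simp_all add: e_def algebra_simps)
  \<comment> \<open>A partial sum fails to be an eigenvector only by terms in \<open>w n\<close> and
    \<open>w (Suc n)\<close>.\<close>
  have "f (p n) = scale (s * of_nat D) (p n) - scale (s * e n * (of_nat D - of_nat n)) (w n)
      + scale (e n * t n * of_nat (Suc n)) (w (Suc n))" if "n \<le> d" for n
    using that
  proof (induction n)
    case 0
    then show ?case by (simp add: p_def e_def w0 algebra_simps f.scale)
  next
    case (Suc n)
    have "f (p (Suc n)) = f (p n) + scale (e (Suc n)) (f (w (Suc n)))"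
      by (simp add: p_def f.add f.scale)
    also have "scale (e (Suc n)) (f (w (Suc n))) =
        scale (s * e n * (of_nat D - of_nat n)) (w n)
        + scale (e (Suc n) * t (Suc n) * of_nat (n + 2)) (w (n + 2))"
      using Suc.prems by (simp add: wS scale_right_distrib eS(1) flip: mult.assoc)
    also have "f (p n) = scale (s * of_nat D) (p n)
        - scale (s * e n * (of_nat D - of_nat n)) (w n)
        + scale (s * e (Suc n) * of_nat (Suc n)) (w (Suc n))"
      using Suc by (simp add: eS(2))
    finally show ?case
      by (simp add: p_def scale_right_distrib algebra_simps)
  qed
  from this[of d] have "f (p d) = scale (s * of_nat D) (p d)
      + scale (s * e d) (scale (of_nat (Suc d)) (w (Suc d)) - scale (of_nat D - of_nat d) (w d))"
    by (simp add: s_def scale_right_diff_distrib mult.commute mult.left_commute del: of_nat_Suc)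
  then have "f (p d) = scale (s * of_nat D) (p d)"
    using wd by simp
  moreover have "p d \<noteq> 0"
  proof
    assume "p d = 0"
    then have "(\<Sum>v\<in>w ` {..d}. scale (e (inv_into {..d} w v)) v) = 0"
      using indep(2) by (simp add: p_def sum.reindex)
    \<comment> \<open>The coefficient of \<open>w 0\<close> is the empty product, hence 1.\<close>
    then have "e (inv_into {..d} w (w 0)) = 0"
      using independentD[OF indep(1) _ subset_refl, where u = "\<lambda>v. e (inv_into {..d} w v)"]
      by simp
    then show False
      using indep(2) by (simp add: e_def)
  qed
  ultimately show ?thesis
    by (auto simp: eigenvector_def s_def)
qed

text \<open>Common form of both types; \<open>w 0\<close> has its own clauses since there is no
  index -1. In \<open>wd\<close> the right coefficient is 0 if \<open>D = d\<close>, giving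
  \<open>w (Suc d) = 0\<close>; if \<open>D = 2d + 1\<close> both coefficients are
  \<open>d + 1\<close>, giving \<open>w (Suc d) = w d\<close>.\<close>

lemma (in anticommutator_triple) string_module_spectrum:
  fixes w :: "nat \<Rightarrow> 'v" and d D :: nat
  defines "s \<equiv> (-1) ^ d"
  assumes D: "D = d \<and> even d \<or> D = 2 * d + 1"
    and basis: "inj_on w {..d}" "is_basis scale (w ` {..d})"
    and f0: "f (w 0) = scale (s * of_nat D) (w 0)"
    and g0: "g (w 0) = scale s (w 1)"
    and gS: "\<And>n. n < d \<Longrightarrow> g (w (Suc n)) =
      scale (s * (of_nat D - of_nat n)) (w n) + scale (s * of_nat (n + 2)) (w (n + 2))"
    and h0: "h (w 0) = w 1"
    and hS: "\<And>n. n < d \<Longrightarrow> h (w (Suc n)) =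
      scale ((-1) ^ n * (of_nat D - of_nat n)) (w n)
      + scale ((-1) ^ Suc n * of_nat (n + 2)) (w (n + 2))"
    and wd: "scale (of_nat (Suc d)) (w (Suc d)) = scale (of_nat D - of_nat d) (w d)"
    and k: "k \<in> {f, g, h}"
  shows "diagonalizable scale k \<and> eigenvalues scale k = string_eigenvalue d D ` {..d}"
proof -
  interpret ghf: anticommutator_triple scale g h f by (rule rotate)
  interpret hfg: anticommutator_triple scale h f g by (rule ghf.rotate)
  let ?m = "of_nat (D * (D + 2)) :: 'k"
  let ?\<Omega> = "\<lambda>u. f (f u) + g (g u) + h (h u)"
  have s: "s * s = 1" by (simp add: s_def flip: power_mult_distrib)
  have ind: "independent (w ` {..d})" and span: "span (w ` {..d}) = UNIV"
    using basis by (auto simp: is_basis_def)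
  have l0: "string_eigenvalue d D 0 = s * of_nat D"
    by (simp add: string_eigenvalue_def s_def)
  \<comment> \<open>To see that the Casimir operator is scalar, it suffices that the subspace
    \<open>K\<close> contains \<open>w 0\<close> and is stable under \<open>g\<close>, since
    \<open>g\<close> generates the other basis vectors from \<open>w 0\<close>.\<close>
  define K where "K = {u. ?\<Omega> u = scale ?m u}"
  have \<Omega>: "?\<Omega> (u + v) = ?\<Omega> u + ?\<Omega> v" "?\<Omega> (scale c u) = scale c (?\<Omega> u)" for u v c
    by (simp_all add: hom_simps scale_right_distrib add_ac)
  have K: "subspace K"
    unfolding K_def subspace_def mem_Collect_eq \<Omega>
    by (simp add: hom_simps scale_right_distrib scale_left_commute del: of_nat_mult)
  have gK: "g u \<in> K" if "u \<in> K" for u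
  proof -
    have "?\<Omega> (g u) = g (?\<Omega> u)"
      using ghf.casimir_commute[of u] by (simp only: add_ac)
    with that show ?thesis by (simp only: K_def mem_Collect_eq g.scale)
  qed
  \<comment> \<open>The operator \<open>h - s g\<close> kills \<open>w 0\<close>, and its square is \<open>g\<^sup>2 + h\<^sup>2 - 2 s f\<close>.\<close>
  have "w 0 \<in> K"
  proof -
    let ?v = "h (w 0) - scale s (g (w 0))"
    have "?v = 0" using s by (simp add: g0 h0)
    then have "h ?v - scale s (g ?v) = 0" by (simp add: hom_simps)
    then have "h (h (w 0)) + g (g (w 0)) = scale s (g (h (w 0)) + h (g (w 0)))"
      using s by (simp add: hom_simps algebra_simps)
    also have "\<dots> = scale (2 * of_nat D) (w 0)"
    proof -
      have "s * (2 * (s * of_nat D)) = 2 * of_nat D" using s by algebra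
      then show ?thesis by (simp only: gh f0 scale_scale)
    qed
    finally have "?\<Omega> (w 0) = scale (s * of_nat D * (s * of_nat D) + 2 * of_nat D) (w 0)"
      by (simp add: f0 hom_simps scale_left_distrib add_ac)
    also have "s * of_nat D * (s * of_nat D) + 2 * of_nat D = ?m"
      using s unfolding of_nat_mult of_nat_add of_nat_numeral by algebra
    finally show ?thesis by (simp add: K_def)
  qed
  have cancel: "u \<in> K" if "a \<noteq> 0" "scale a u \<in> K" for a u
    using subspace_scale[OF K that(2), of "inverse a"] that(1) by simp
  have "w n \<in> K" if "n \<le> d" for n
    using that
  proof (induction n rule: less_induct)
    case (less n)
    \<comment> \<open>Here \<open>a\<close> is the coefficient of \<open>w n\<close> in
      \<open>g (w (n - 1))\<close>, nonzero in characteristic zero; the remaining term is a multiple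
      of \<open>w (n - 2)\<close>, present only for \<open>n > 1\<close>.\<close>
    have "\<exists>a. a \<noteq> 0 \<and> scale a (w n) \<in> K" if "n \<noteq> 0"
    proof (cases "n = 1")
      case True
      then show ?thesis
        using gK[OF \<open>w 0 \<in> K\<close>] s by (intro exI[of _ s]) (auto simp: g0)
    next
      case False
      with that have "n = (n - 2) + 2" by simp
      then obtain i where i: "n = i + 2" by blast
      have "g (w (Suc i)) - scale (s * (of_nat D - of_nat i)) (w i) \<in> K"
        using less i by (intro subspace_diff subspace_scale K gK) auto
      then have "scale (s * of_nat (i + 2)) (w n) \<in> K"
        using less.prems i by (simp add: gS)
      moreover have "s * of_nat (i + 2) \<noteq> 0"
        using s unfolding mult_eq_0_iff of_nat_eq_0_iff by auto
      ultimately show ?thesis by blast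
    qed
    then show ?case
      using \<open>w 0 \<in> K\<close> cancel by (cases "n = 0") auto
  qed
  then have "span (w ` {..d}) \<subseteq> K"
    by (intro span_minimal K) auto
  then have cas: "?\<Omega> u = scale ?m u" for u
    using span by (auto simp: K_def)
  have "d \<le> D" using D by auto
  have "string_eigenvalue d D ` {..d} \<subseteq> eigenvalues scale k"
  proof -
    consider "k = f" | "k = g" | "k = h" using k by blast
    then show ?thesis
    proof cases
      case 1
      have "w 0 \<noteq> 0" using ind dependent_zero by fastforce
      then have "eigenvector scale f (string_eigenvalue d D 0) (w 0)"
        by (simp add: eigenvector_def f0 l0)
      from string_eigenvalues[OF cas this \<open>d \<le> D\<close>] 1 show ?thesis by auto
    next
      case 2
      \<comment> \<open>Constant signs \<open>s\<close> for \<open>g\<close>, signs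
        \<open>(-1) ^ n\<close> for \<open>h\<close> below: both take the value \<open>s\<close> at
        \<open>d\<close>, so both start at \<open>s * D\<close>, as \<open>f\<close> does at
        \<open>w 0\<close>.\<close>
      obtain u where "eigenvector scale g (string_eigenvalue d D 0) u"
        using string_eigenvector[OF lin(2), of w "\<lambda>_. s" d D] g0 gS wd s ind basis(1) l0 by auto
      from ghf.string_eigenvalues[OF _ this \<open>d \<le> D\<close>] cas 2 show ?thesis by (auto simp: add_ac)
    next
      case 3
      obtain u where "eigenvector scale h (string_eigenvalue d D 0) u"
        using string_eigenvector[OF lin(3), of w "\<lambda>n. (-1) ^ n" d D] h0 hS wd ind basis(1) l0
        by (auto simp: s_def simp flip: power_mult_distrib)
      from hfg.string_eigenvalues[OF _ this \<open>d \<le> D\<close>] cas 3 show ?thesis by (auto simp: add_ac)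
    qed
  qed
  moreover have "Vector_Spaces.linear scale scale k" using k lin by auto
  moreover have "card (w ` {..d}) \<le> card (string_eigenvalue d D ` {..d} :: 'k set)"
    using inj_on_string_eigenvalue[OF D, where 'k = 'k] basis(1) by (simp add: card_image)
  ultimately show ?thesis
    using diagonalizable_if_enough_eigenvalues[of k "w ` {..d}" "string_eigenvalue d D ` {..d}"]
      basis(2) by simp
qed

section \<open>The modules of the two types\<close>

lemma A_module_anticommutator_triple:
  fixes scale :: "'k::field_char_0 \<Rightarrow> 'v::ab_group_add \<Rightarrow> 'v"
  assumes "A_module scale act"
  shows "anticommutator_triple scale (act (gen_A X)) (act (gen_A Y)) (act (gen_A Z))"
proof -
  interpret A_module scale act by fact
  have "act a (act b v) + act b (act a v) = act (a * b + b * a) v" for a b v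
    by (simp only: act_mult act_add)
  then show ?thesis
    by (intro anticommutator_triple.intro anticommutator_triple_axioms.intro
        vector_space_axioms act_linear) (simp_all only: alg_A_relations act_scale)
qed

lemma image_of_nat_atMost: "int ` {..d} = {0..int d}"
  by (metis atLeast0AtMost image_int_atLeastAtMost of_nat_0)

lemma type_B_spectrum:
  fixes scale :: "'k::field_char_0 \<Rightarrow> 'v::ab_group_add \<Rightarrow> 'v"
  assumes "type_B d scale act" and g: "g \<in> {X, Y, Z}"
  shows "diagonalizable scale (act (gen_A g)) \<and>
    eigenvalues scale (act (gen_A g)) = string_eigenvalue d d ` {..d}"
proof -
  obtain v :: "int \<Rightarrow> 'v" where "even d" and mod: "A_module scale act"
    and v: "inj_on v {0..int d}" "is_basis scale (v ` {0..int d})"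
      "v (-1) = 0" "v (int d + 1) = 0"
    and act: "\<And>i. i \<in> {0..int d} \<Longrightarrow>
       act (gen_A X) (v i) = scale ((-1) powi i * of_int (int d - 2 * i)) (v i) \<and>
       act (gen_A Y) (v i) =
         scale (of_int (int d - i + 1)) (v (i - 1)) + scale (of_int (i + 1)) (v (i + 1)) \<and>
       act (gen_A Z) (v i) =
         scale ((-1) powi (i - 1) * of_int (int d - i + 1)) (v (i - 1)) +
         scale ((-1) powi i * of_int (i + 1)) (v (i + 1))"
    using assms unfolding type_B_def irreducible_A_module_def by blast
  interpret anticommutator_triple scale "act (gen_A X)" "act (gen_A Y)" "act (gen_A Z)"
    by (rule A_module_anticommutator_triple) fact
  show ?thesis
  proof (rule string_module_spectrum[where w = "\<lambda>n. v (int n)"])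
    show "d = d \<and> even d \<or> d = 2 * d + 1" using \<open>even d\<close> by simp
    show "inj_on (\<lambda>n. v (int n)) {..d}" "is_basis scale ((\<lambda>n. v (int n)) ` {..d})"
      using v comp_inj_on[of int "{..d}" v] image_comp[of v int "{..d}"]
      by (simp_all add: image_of_nat_atMost comp_def)
    \<comment> \<open>The term in \<open>v (-1)\<close> vanishes at \<open>i = 0\<close>, and
      \<open>(-1) ^ d = 1\<close> because \<open>d\<close> is even.\<close>
    show "act (gen_A X) (v (int 0)) = scale ((-1) ^ d * of_nat d) (v (int 0))"
      "act (gen_A Y) (v (int 0)) = scale ((-1) ^ d) (v (int 1))"
      "act (gen_A Z) (v (int 0)) = v (int 1)"
      using act[of 0] v \<open>even d\<close> by simp_all
    show "scale (of_nat (Suc d)) (v (int (Suc d))) = scale (of_nat d - of_nat d) (v (int d))"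
      using v by (simp add: add.commute)
    fix n assume n: "n < d"
    show "act (gen_A Y) (v (int (Suc n))) =
        scale ((-1) ^ d * (of_nat d - of_nat n)) (v (int n)) +
        scale ((-1) ^ d * of_nat (n + 2)) (v (int (n + 2)))"
      "act (gen_A Z) (v (int (Suc n))) =
        scale ((-1) ^ n * (of_nat d - of_nat n)) (v (int n)) +
        scale ((-1) ^ Suc n * of_nat (n + 2)) (v (int (n + 2)))"
      using act[of "int n + 1"] n \<open>even d\<close>
      by (simp_all add: power_int_add algebra_simps)
  qed (use g in auto)
qed

lemma type_AB0_spectrum:
  fixes scale :: "'k::field_char_0 \<Rightarrow> 'v::ab_group_add \<Rightarrow> 'v"
  assumes "type_AB0 d scale act" and g: "g \<in> {X, Y, Z}"
  shows "diagonalizable scale (act (gen_A g)) \<and>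
    eigenvalues scale (act (gen_A g)) = string_eigenvalue d (2 * d + 1) ` {..d}"
proof -
  obtain v :: "int \<Rightarrow> 'v" where mod: "A_module scale act"
    and v: "inj_on v {0..int d}" "is_basis scale (v ` {0..int d})"
      "v (-1) = 0" "v (int d + 1) = v (int d)"
    and act: "\<And>i. i \<in> {0..int d} \<Longrightarrow>
       act (gen_A X) (v i) =
         scale ((-1) powi (int d + i) * of_int (2 * int d - 2 * i + 1)) (v i) \<and>
       act (gen_A Y) (v i) =
         scale ((-1) ^ d * of_int (2 * int d - i + 2)) (v (i - 1)) +
         scale ((-1) ^ d * of_int (i + 1)) (v (i + 1)) \<and>
       act (gen_A Z) (v i) =
         scale ((-1) powi (i - 1) * of_int (2 * int d - i + 2)) (v (i - 1)) +
         scale ((-1) powi i * of_int (i + 1)) (v (i + 1))"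
    using assms unfolding type_AB0_def irreducible_A_module_def by blast
  interpret anticommutator_triple scale "act (gen_A X)" "act (gen_A Y)" "act (gen_A Z)"
    by (rule A_module_anticommutator_triple) fact
  show ?thesis
  proof (rule string_module_spectrum[where w = "\<lambda>n. v (int n)"])
    show "2 * d + 1 = d \<and> even d \<or> 2 * d + 1 = 2 * d + 1" by simp
    show "inj_on (\<lambda>n. v (int n)) {..d}" "is_basis scale ((\<lambda>n. v (int n)) ` {..d})"
      using v comp_inj_on[of int "{..d}" v] image_comp[of v int "{..d}"]
      by (simp_all add: image_of_nat_atMost comp_def)
    show "act (gen_A X) (v (int 0)) = scale ((-1) ^ d * of_nat (2 * d + 1)) (v (int 0))"
      "act (gen_A Y) (v (int 0)) = scale ((-1) ^ d) (v (int 1))"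
      "act (gen_A Z) (v (int 0)) = v (int 1)"
      using act[of 0] v by simp_all
    show "scale (of_nat (Suc d)) (v (int (Suc d))) =
        scale (of_nat (2 * d + 1) - of_nat d) (v (int d))"
      using v by (simp add: add.commute)
    fix n assume n: "n < d"
    show "act (gen_A Y) (v (int (Suc n))) =
        scale ((-1) ^ d * (of_nat (2 * d + 1) - of_nat n)) (v (int n)) +
        scale ((-1) ^ d * of_nat (n + 2)) (v (int (n + 2)))"
      "act (gen_A Z) (v (int (Suc n))) =
        scale ((-1) ^ n * (of_nat (2 * d + 1) - of_nat n)) (v (int n)) +
        scale ((-1) ^ Suc n * of_nat (n + 2)) (v (int (n + 2)))"
      \<comment> \<open>At \<open>i = n + 1\<close> the coefficient \<open>2d - i + 2\<close>
        becomes \<open>D - n\<close> with \<open>D = 2d + 1\<close>.\<close>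
      using act[of "int n + 1"] n
      by (simp_all add: power_int_add algebra_simps)
  qed (use g in auto)
qed

lemma image_atMost_conv_int: "(\<lambda>n. F (int n)) ` {..d} = {F i | i. 0 \<le> i \<and> i \<le> int d}"
  unfolding image_image[of F int, symmetric] image_of_nat_atMost by auto

theorem proposition5p2:
  fixes scale :: "'k::{alg_closed_field, field_char_0} \<Rightarrow> 'v::ab_group_add \<Rightarrow> 'v"
    and act :: "'k alg_A \<Rightarrow> 'v \<Rightarrow> 'v"
    and d :: nat
  assumes "irreducible_A_module scale act"
    and "finite_dim scale"
    and "type_B d scale act \<or> type_AB0 d scale act"
  shows "(\<forall>g\<in>{X, Y, Z}. diagonalizable scale (act (gen_A g))) \<and>
    (type_B d scale act \<longrightarrow>
      (\<forall>g\<in>{X, Y, Z}. eigenvalues scale (act (gen_A g)) =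
         {(-1) powi i * of_int (int d - 2 * i) | i. 0 \<le> i \<and> i \<le> int d})) \<and>
    (type_AB0 d scale act \<longrightarrow>
      (\<forall>g\<in>{X, Y, Z}. eigenvalues scale (act (gen_A g)) =
         {(-1) powi (int d + i) * of_int (2 * int d - 2 * i + 1) | i. 0 \<le> i \<and> i \<le> int d}))"
proof -
  have "string_eigenvalue d d ` {..d} =
      {(-1) powi i * of_int (int d - 2 * i) :: 'k | i. 0 \<le> i \<and> i \<le> int d}"
    if "type_B d scale act"
  proof -
    \<comment> \<open>Evenness removes the factor \<open>(-1) ^ d\<close> from
      \<open>string_eigenvalue\<close>.\<close>
    have "even d" using that by (simp add: type_B_def)
    then show ?thesis
      unfolding image_atMost_conv_int[where F = "\<lambda>i. (-1) powi i * of_int (int d - 2 * i)", symmetric]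
      by (simp add: string_eigenvalue_def power_add)
  qed
  moreover have "string_eigenvalue d (2 * d + 1) ` {..d} =
      {(-1) powi (int d + i) * of_int (2 * int d - 2 * i + 1) :: 'k | i. 0 \<le> i \<and> i \<le> int d}"
    unfolding image_atMost_conv_int
      [where F = "\<lambda>i. (-1) powi (int d + i) * of_int (2 * int d - 2 * i + 1)", symmetric]
    by (intro image_cong refl)
      (simp add: string_eigenvalue_def power_int_add power_add algebra_simps)
  ultimately show ?thesis
    using assms(3) type_B_spectrum[of d scale act] type_AB0_spectrum[of d scale act] by auto
qed

end
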